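(* For every fixed $k\ge2$ and $\ell\ge1$, every with-high-probability successful fixed-support canonical sketch family $\mathcal A$ (with parameters $k,\ell$) satisfies $$\liminf_{d\to\infty}\frac{\mathfrak C_{\mathcal A}(d)}{d}\ \ge\ \frac{\ell}{\rho_{k,\ell}}\ >\ 1,$$ where $\rho_{k,\ell}\in(0,\ell)$ is the unique positive root of the equation $$\rho=\mathbb E\big[\min\{\ell,\operatorname{Pois}(k\rho)\}\big].$$
   Context: **Universe.** $\mathcal U=\mathbb F_p$ with $p$ prime, $V=p$, $\mathcal U^*=\mathcal U\setminus\{0\}$; limits $V\to\infty$ are over primes; $o_V(1)$ means tending to $0$ as $V\to\infty$ for fixed $d$; $[n]=\{1,\dots,n\}$. $\operatorname{Pois}(\lambda)$ denotes a Poisson random variable with mean $\lambda$. **Fixed-support canonical sketch family** (fixed constants $k,\ell\ge1$). For every $d,V$, a family $\mathcal A$ samples public randomness $\omega$; after fixing $\omega$, encoding and decoding are deterministic. It maintains $M_d$ persistent cells ($M_d$ depends on $d$ only, not on $V$), which hold all persistent information; each cell has at most $V^{\ell+r_d(V)}$ possible states, where $r_d(V)=o_V(1)$ for each fixed $d$. Put $\mathfrak C_{\mathcal A}(d):=\ell M_d$. For each $\omega$ there are an encoding map $\mathsf{Enc}^\omega_{d,V}$ from subsets of $\mathcal U^*$ to sketch states and, for each $x\in\mathcal U^*$, an update map $\mathsf{Upd}^\omega_{d,V,x}$ on sketch states such that: (1) *Fixed support*: each $x\in\mathcal U^*$ has a predetermined write support $S^\omega_{d,V}(x)\subseteq[M_d]$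 with $|S^\omega_{d,V}(x)|\le k$; $\mathsf{Upd}^\omega_{d,V,x}$ may depend on the whole state but changes only cells in $S^\omega_{d,V}(x)$. (2) *Canonicality*: for all $A\subseteq\mathcal U^*$ and $x\in\mathcal U^*\setminus A$, $\mathsf{Enc}^\omega_{d,V}(A\cup\{x\})=\mathsf{Upd}^\omega_{d,V,x}(\mathsf{Enc}^\omega_{d,V}(A))$. The decoder $\mathsf{Dec}^\omega_{d,V}$ is an arbitrary function of a pair of sketch states; on $(\mathsf{Enc}(A),\mathsf{Enc}(B))$ it aims to output $(A\setminus B,B\setminus A)$. With $D$ uniform among the $d$-subsets of $\mathcal U^*$, $\operatorname{Succ}^\omega_{d,V}(\mathcal A):=\Pr_D[\mathsf{Dec}^\omega_{d,V}(\mathsf{Enc}^\omega_{d,V}(D),\mathsf{Enc}^\omega_{d,V}(\varnothing))=(D,\varnothing)]$ and $\operatorname{Succ}_{d,V}(\mathcal A):=\mathbb E_\omega[\operatorname{Succ}^\omega_{d,V}(\mathcal A)]$. $\mathcal A$ is *with-high-probability successful* if $\lim_{d\to\infty}\liminf_{V\to\infty}\operatorname{Succ}_{d,V}(\mathcal A)=1$. *)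

theory Defs
  imports "HOL-Probability.Probability" "HOL-Number_Theory.Residues"
begin

definition nz_universe :: "nat \<Rightarrow> int set" where
  "nz_universe V = carrier (residue_ring (int V)) - {\<zero>\<^bsub>residue_ring (int V)\<^esub>}"

text \<open>The filter for limits as \<open>V\<close> tends to infinity over the primes.\<close>

definition primes_at_top :: "nat filter" where
  "primes_at_top = inf at_top (principal {V. prime V})"

text \<open>
  A family of sketches. The leading arguments are always \<open>d\<close> and \<open>V\<close>, followed (where present)
  by a value \<open>\<omega> :: 'w\<close> of the public randomness, whose law is \<open>randomness d V\<close>.
  A sketch state is a function from cell indices to cell contents of type \<open>'c\<close>;
  \<open>cell_values d V i\<close> is the set of possible contents of cell \<open>i\<close>.
\<close>

record ('w, 'c) sketch_family =
  num_cells :: "nat \<Rightarrow> nat"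
  randomness :: "nat \<Rightarrow> nat \<Rightarrow> 'w measure"
  cell_values :: "nat \<Rightarrow> nat \<Rightarrow> nat \<Rightarrow> 'c set"
  encode :: "nat \<Rightarrow> nat \<Rightarrow> 'w \<Rightarrow> int set \<Rightarrow> (nat \<Rightarrow> 'c)"
  update :: "nat \<Rightarrow> nat \<Rightarrow> 'w \<Rightarrow> int \<Rightarrow> (nat \<Rightarrow> 'c) \<Rightarrow> (nat \<Rightarrow> 'c)"
  write_support :: "nat \<Rightarrow> nat \<Rightarrow> 'w \<Rightarrow> int \<Rightarrow> nat set"
  decode :: "nat \<Rightarrow> nat \<Rightarrow> 'w \<Rightarrow> (nat \<Rightarrow> 'c) \<times> (nat \<Rightarrow> 'c) \<Rightarrow> int set \<times> int set"

definition sketch_states :: "('w, 'c) sketch_family \<Rightarrow> nat \<Rightarrow> nat \<Rightarrow> (nat \<Rightarrow> 'c) set" where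
  "sketch_states \<A> d V = (\<Pi>\<^sub>E i\<in>{1..num_cells \<A> d}. cell_values \<A> d V i)"

text \<open>
  The probability is the intended one only if \<open>d < V\<close>: otherwise there are no \<open>d\<close>-subsets and
  \<^const>\<open>pmf_of_set\<close> is unspecified. This does not affect limits in \<open>V\<close> for fixed \<open>d\<close>.
\<close>

definition succ_given :: "('w, 'c) sketch_family \<Rightarrow> nat \<Rightarrow> nat \<Rightarrow> 'w \<Rightarrow> real" where
  "succ_given \<A> d V \<omega> =
     measure_pmf.prob (pmf_of_set {D. D \<subseteq> nz_universe V \<and> card D = d})
       {D. decode \<A> d V \<omega> (encode \<A> d V \<omega> D, encode \<A> d V \<omega> {}) = (D, {})}"

definition succ_prob :: "('w, 'c) sketch_family \<Rightarrow> nat \<Rightarrow> nat \<Rightarrow> real" where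
  "succ_prob \<A> d V = (\<integral>\<omega>. succ_given \<A> d V \<omega> \<partial>randomness \<A> d V)"

text \<open>
  The measurability condition is what gives the expectation in \<^const>\<open>succ_prob\<close> a meaning; the
  Bochner integral of a nonmeasurable function would be \<open>0\<close>.
\<close>

definition fixed_support_canonical ::
  "nat \<Rightarrow> nat \<Rightarrow> ('w, 'c) sketch_family \<Rightarrow> bool" where
  "fixed_support_canonical k l \<A> \<longleftrightarrow>
     (\<forall>d V. prime V \<longrightarrow>
        prob_space (randomness \<A> d V) \<and>
        (d < V \<longrightarrow> succ_given \<A> d V \<in> borel_measurable (randomness \<A> d V))) \<and>
     (\<exists>r :: nat \<Rightarrow> nat \<Rightarrow> real.
        (\<forall>d. (r d \<longlongrightarrow> 0) primes_at_top) \<and>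
        (\<forall>d V. prime V \<longrightarrow> (\<forall>i\<in>{1..num_cells \<A> d}.
           finite (cell_values \<A> d V i) \<and>
           real (card (cell_values \<A> d V i)) \<le> real V powr (real l + r d V)))) \<and>
     (\<forall>d V. prime V \<longrightarrow> (\<forall>\<omega>\<in>space (randomness \<A> d V).
        (\<forall>A. A \<subseteq> nz_universe V \<longrightarrow> encode \<A> d V \<omega> A \<in> sketch_states \<A> d V) \<and>
        (\<forall>x\<in>nz_universe V.
           write_support \<A> d V \<omega> x \<subseteq> {1..num_cells \<A> d} \<and>
           card (write_support \<A> d V \<omega> x) \<le> k \<and>
           (\<forall>s\<in>sketch_states \<A> d V.
              update \<A> d V \<omega> x s \<in> sketch_states \<A> d V \<and>
              (\<forall>i\<in>{1..num_cells \<A> d} - write_support \<A> d V \<omega> x.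
                 update \<A> d V \<omega> x s i = s i))) \<and>
        (\<forall>A x. A \<subseteq> nz_universe V \<and> x \<in> nz_universe V - A \<longrightarrow>
           encode \<A> d V \<omega> (A \<union> {x}) = update \<A> d V \<omega> x (encode \<A> d V \<omega> A))))"

definition whp_successful :: "('w, 'c) sketch_family \<Rightarrow> bool" where
  "whp_successful \<A> \<longleftrightarrow>
     ((\<lambda>d. Liminf primes_at_top (\<lambda>V. ereal (succ_prob \<A> d V))) \<longlongrightarrow> 1) sequentially"

definition sketch_cost :: "nat \<Rightarrow> ('w, 'c) sketch_family \<Rightarrow> nat \<Rightarrow> nat" where
  "sketch_cost l \<A> d = l * num_cells \<A> d"

definition positive_root :: "nat \<Rightarrow> nat \<Rightarrow> real \<Rightarrow> bool" where
  "positive_root k l \<rho> \<longleftrightarrow>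
     \<rho> > 0 \<and>
     \<rho> = measure_pmf.expectation (poisson_pmf (real k * \<rho>)) (\<lambda>n. min (real l) (real n))"

definition rho :: "nat \<Rightarrow> nat \<Rightarrow> real" where
  "rho k l = (THE \<rho>. positive_root k l \<rho>)"

end

theory Submission
  imports Defs "HOL-Real_Asymp.Real_Asymp"
begin

text \<open>
  By canonicality the elements of \<open>D\<close> that do not write to cell \<open>i\<close> may be inserted last, so cell \<open>i\<close> of
  the encoding depends only on the set of the \<open>N\<^sub>i\<close> elements of \<open>D\<close> that write to it. Given the
  loads \<open>N\<^sub>i\<close>, this cell takes at most about \<open>V\<close> to the power \<open>min l N\<^sub>i\<close> values. As encodings of
  successfully decoded sets are distinct, sets with \<open>(\<Sum>i. min l N\<^sub>i) < d\<close> contribute a vanishing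
  proportion of successes when \<open>V\<close> grows; by Markov's inequality the success probability is
  asymptotically at most the mean of \<open>(\<Sum>i. min l N\<^sub>i) / d\<close>. Up to an error of order \<open>sqrt d\<close> in the sum,
  \<open>N\<^sub>i\<close> can be replaced by a Poisson variable of the same mean; write \<open>f x\<close> for the mean of \<open>min l (Pois x)\<close>.
  The loads have total mean at most \<open>k d\<close>, so concavity of \<open>f\<close> bounds the success probability by
  \<open>(M / d) f (k d / M)\<close> up to \<open>o(1)\<close>. Since \<open>f x / x\<close> is strictly decreasing, this stays below \<open>1\<close> if
  \<open>M / d\<close> is bounded away from \<open>1 / \<rho>\<close> from below.
\<close>

section \<open>Truncated Poisson means\<close>

text \<open>
  For \<open>x \<ge> 0\<close>, \<open>pois_below n x\<close> is the probability that a Poisson variable with mean \<open>x\<close> is less than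
  \<open>n\<close>, and \<open>trunc_pois n x\<close> is the mean of its minimum with \<open>n\<close>, as a sum of tail probabilities.
\<close>

definition pois_below :: "nat \<Rightarrow> real \<Rightarrow> real" where
  "pois_below n x = exp (- x) * (\<Sum>i<n. x ^ i / fact i)"

definition trunc_pois :: "nat \<Rightarrow> real \<Rightarrow> real" where
  "trunc_pois n x = (\<Sum>j<n. 1 - pois_below (Suc j) x)"

text \<open>\<open>min l n\<close> counts the \<open>j < l\<close> with \<open>j < n\<close>, so by
  linearity the mean is the sum of the probabilities of exceeding \<open>j\<close>.\<close>

lemma expectation_min_poisson:
  assumes "x > 0"
  shows "measure_pmf.expectation (poisson_pmf x) (\<lambda>n. min (real l) (real n)) = trunc_pois l x"
proof -
  have min_eq: "min (real l) (real n) = (\<Sum>j<l. indicator {j<..} n)" for n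
  proof -
    have "(\<Sum>j<l. indicator {j<..} n :: real) = real (card {j. j < l \<and> j < n})"
      by (simp add: indicator_def of_bool_def sum.If_cases Int_def)
    also have "{j. j < l \<and> j < n} = {..<min l n}" by auto
    finally show ?thesis by (simp add: of_nat_min)
  qed
  have tail: "measure_pmf.prob (poisson_pmf x) {j<..} = 1 - pois_below (Suc j) x" for j
  proof -
    have "measure_pmf.prob (poisson_pmf x) {j<..} = 1 - measure_pmf.prob (poisson_pmf x) {..j}"
      using measure_pmf.prob_compl[of "{..j}" "poisson_pmf x"] by (simp add: Compl_eq_Diff_UNIV[symmetric])
    also have "measure_pmf.prob (poisson_pmf x) {..j} = pois_below (Suc j) x"
      using assms by (simp add: measure_measure_pmf_finite pois_below_def sum_distrib_left
          lessThan_Suc_atMost mult.commute)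
    finally show ?thesis .
  qed
  show ?thesis
    unfolding min_eq trunc_pois_def tail[symmetric]
    by (subst Bochner_Integration.integral_sum)
      (auto intro!: measure_pmf.integrable_const_bound[where B = 1] simp: indicator_def)
qed

section \<open>Derivatives, monotonicity and concavity of the truncated means\<close>

lemma pois_below_0 [simp]: "pois_below 0 x = 0"
  by (simp add: pois_below_def)

lemma pois_below_at_0 [simp]: "pois_below (Suc n) 0 = 1"
  by (simp add: pois_below_def sum.lessThan_Suc_shift del: sum.lessThan_Suc)

lemma trunc_pois_0 [simp]: "trunc_pois 0 x = 0"
  by (simp add: trunc_pois_def)

lemma trunc_pois_at_0 [simp]: "trunc_pois n 0 = 0"
  by (simp add: trunc_pois_def)

lemma trunc_pois_Suc: "trunc_pois (Suc n) x = 1 + trunc_pois n x - pois_below (Suc n) x"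
  by (simp add: trunc_pois_def)

text \<open>Each Poisson weight has as derivative the preceding weight minus itself, so the sum
  telescopes and only the last weight survives, with a minus sign.\<close>

lemma DERIV_pois_below_Suc:
  "(pois_below (Suc n) has_real_derivative - exp (- x) * x ^ n / fact n) (at x)"
proof (induction n)
  case 0
  show ?case unfolding pois_below_def by (auto intro!: derivative_eq_intros)
next
  case (Suc n)
  have eq: "pois_below (Suc (Suc n)) = (\<lambda>x. pois_below (Suc n) x + exp (- x) * x ^ Suc n / fact (Suc n))"
    by (rule ext) (simp add: pois_below_def algebra_simps)
  have "((\<lambda>x. exp (- x) * x ^ Suc n / fact (Suc n)) has_real_derivative
     exp (- x) * x ^ n / fact n - exp (- x) * x ^ Suc n / fact (Suc n)) (at x)"
    by (auto intro!: derivative_eq_intros simp del: power_Suc fact_Suc simp: field_simps)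
      (simp add: field_simps)
  from DERIV_add[OF Suc.IH this] show ?case unfolding eq by simp
qed

lemma pois_term_bounds:
  assumes "x \<ge> (0::real)"
  shows "exp (- x) * x ^ n / fact n \<le> 1"
proof -
  have "x ^ n / fact n = (\<Sum>i\<in>{n}. x ^ i / fact i)" by simp
  also have "\<dots> \<le> (\<Sum>i. x ^ i / fact i)"
    using assms summable_exp[of x] by (intro sum_le_suminf) (auto simp: field_simps)
  also have "\<dots> = exp x" by (simp add: exp_def field_simps)
  finally show ?thesis by (simp add: exp_minus field_simps)
qed

lemma pois_below_nonneg: "x \<ge> 0 \<Longrightarrow> pois_below n x \<ge> 0"
  by (auto simp: pois_below_def intro!: mult_nonneg_nonneg sum_nonneg)

lemma pois_below_strict_antimono:
  assumes "0 \<le> x" "x < y"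
  shows "pois_below (Suc n) y < pois_below (Suc n) x"
proof -
  from MVT2[OF assms(2) DERIV_pois_below_Suc] obtain z where
    z: "x < z" "z < y" "pois_below (Suc n) y - pois_below (Suc n) x = (y - x) * (- exp (- z) * z ^ n / fact n)"
    by blast
  have "(y - x) * (- exp (- z) * z ^ n / fact n) < 0"
    using z assms by (intro mult_pos_neg) (auto simp: divide_less_0_iff)
  with z(3) show ?thesis by linarith
qed

lemma pois_below_antimono: "0 \<le> x \<Longrightarrow> x \<le> y \<Longrightarrow> pois_below n y \<le> pois_below n x"
  using pois_below_strict_antimono by (cases n; cases "x = y") (auto simp: less_imp_le)

text \<open>The slope is minus a Poisson weight, hence at least -1. This Lipschitz bound controls
  the error in \<open>trunc_pois_step\<close>.\<close>

lemma pois_below_diff_le: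
  assumes "0 \<le> x" "x \<le> y"
  shows "pois_below n x - pois_below n y \<le> y - x"
proof (cases n)
  case (Suc m)
  show ?thesis
  proof (cases "x = y")
    case False
    then have "x < y" using assms by simp
    from MVT2[OF this DERIV_pois_below_Suc] obtain z where
      z: "x < z" "z < y" "pois_below (Suc m) y - pois_below (Suc m) x = (y - x) * (- exp (- z) * z ^ m / fact m)"
      by blast
    have "(y - x) * (exp (- z) * z ^ m / fact m) \<le> (y - x) * 1"
      using z assms by (intro mult_left_mono pois_term_bounds) auto
    with z(3) Suc show ?thesis by simp
  qed simp
qed (use assms in auto)

text \<open>The new summand \<open>1 - pois_below (Suc n)\<close> has the \<open>n\<close>-th
  Poisson weight as derivative, which is exactly the gap between \<open>pois_below (Suc n)\<close>
  and \<open>pois_below n\<close>.\<close>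

lemma DERIV_trunc_pois: "(trunc_pois n has_real_derivative pois_below n x) (at x)"
proof (induction n)
  case 0
  have "trunc_pois 0 = (\<lambda>_. 0)" by (rule ext) simp
  then show ?case by simp
next
  case (Suc n)
  have "trunc_pois (Suc n) = (\<lambda>x. 1 + trunc_pois n x - pois_below (Suc n) x)"
    by (rule ext) (rule trunc_pois_Suc)
  moreover have "pois_below (Suc n) x = 0 + pois_below n x - (- exp (- x) * x ^ n / fact n)"
    by (simp add: pois_below_def algebra_simps)
  ultimately show ?case
    using DERIV_diff[OF DERIV_add[OF DERIV_const Suc.IH] DERIV_pois_below_Suc] by (simp only:)
qed

text \<open>This is concavity on the nonnegative axis: the derivative \<open>pois_below n\<close>
  decreases there, so the graph lies below its tangents.\<close>

lemma trunc_pois_le_tangent: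
  assumes "0 \<le> x" "0 \<le> y"
  shows "trunc_pois n y \<le> trunc_pois n x + pois_below n x * (y - x)"
proof (cases x y rule: linorder_cases)
  case less
  from MVT2[OF less DERIV_trunc_pois] obtain z where
    z: "x < z" "z < y" "trunc_pois n y - trunc_pois n x = (y - x) * pois_below n z" by blast
  have "(y - x) * pois_below n z \<le> (y - x) * pois_below n x"
    using z assms by (intro mult_left_mono pois_below_antimono) auto
  with z(3) show ?thesis by (simp add: mult.commute)
next
  case greater
  from MVT2[OF greater DERIV_trunc_pois] obtain z where
    z: "y < z" "z < x" "trunc_pois n x - trunc_pois n y = (x - y) * pois_below n z" by blast
  have "(x - y) * pois_below n x \<le> (x - y) * pois_below n z"
    using z assms by (intro mult_left_mono pois_below_antimono) auto
  with z(3) show ?thesis by (simp add: algebra_simps)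
qed simp

lemma trunc_pois_nonneg: "0 \<le> x \<Longrightarrow> 0 \<le> trunc_pois n x"
  using trunc_pois_le_tangent[of x 0 n] pois_below_nonneg[of x n]
  by (simp add: mult_nonneg_nonneg) (smt (verit) mult_nonneg_nonneg)

text \<open>The left side models one more draw that hits with probability \<open>p\<close>: it
  raises a load truncated at \<open>n\<close> only if that load is still below \<open>n\<close>. The
  tangent at \<open>x + p\<close> gives the bound up to the change of slope, which costs at most
  \<open>p * p\<close>.\<close>

lemma trunc_pois_step:
  assumes "0 \<le> x" "0 \<le> p"
  shows "trunc_pois n x + p * pois_below n x \<le> trunc_pois n (x + p) + p\<^sup>2"
proof -
  have "trunc_pois n x \<le> trunc_pois n (x + p) + pois_below n (x + p) * (x - (x + p))"
    using assms by (intro trunc_pois_le_tangent) auto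
  moreover have "p * (pois_below n x - pois_below n (x + p)) \<le> p * p"
    using assms pois_below_diff_le[of x "x + p" n] by (intro mult_left_mono) auto
  ultimately show ?thesis by (simp add: algebra_simps power2_eq_square)
qed

text \<open>The mean slope between 0 and \<open>x\<close> exceeds the slope at \<open>x\<close>,
  because the slope decreases strictly.\<close>

lemma trunc_pois_gt_pois_below:
  assumes "0 < x"
  shows "x * pois_below (Suc n) x < trunc_pois (Suc n) x"
proof -
  from MVT2[OF assms DERIV_trunc_pois] obtain z where
    z: "0 < z" "z < x" "trunc_pois (Suc n) x - trunc_pois (Suc n) 0 = (x - 0) * pois_below (Suc n) z"
    by blast
  then show ?thesis using pois_below_strict_antimono[of z x n] assms by simp
qed

text \<open>The numerator in the quotient rule is negative by
  \<open>trunc_pois_gt_pois_below\<close>. Both the uniqueness of the root and the final comparison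
  rest on this monotonicity.\<close>

lemma trunc_pois_ratio_strict_antimono:
  assumes "0 < x" "x < y" "n \<ge> 1"
  shows "trunc_pois n y / y < trunc_pois n x / x"
proof (rule DERIV_neg_imp_decreasing[OF assms(2)])
  fix t assume t: "x \<le> t" "t \<le> y"
  obtain m where m: "n = Suc m" using assms(3) by (cases n) auto
  have "((\<lambda>t. trunc_pois n t / t) has_real_derivative
      (pois_below n t * t - trunc_pois n t * 1) / (t * t)) (at t)"
    using t assms by (intro DERIV_divide DERIV_trunc_pois) auto
  moreover have "(pois_below n t * t - trunc_pois n t * 1) / (t * t) < 0"
    using trunc_pois_gt_pois_below[of t m] t assms m
    by (auto simp: divide_less_0_iff mult.commute)
  ultimately show "\<exists>y. ((\<lambda>t. trunc_pois n t / t) has_real_derivative y) (at t) \<and> y < 0"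
    by blast
qed

lemma trunc_pois_less:
  assumes "0 \<le> x" "n \<ge> 1"
  shows "trunc_pois n x < real n"
proof -
  have "trunc_pois n x < (\<Sum>j<n. 1)" unfolding trunc_pois_def
  proof (rule sum_strict_mono)
    fix j assume "j \<in> {..<n}"
    have "(\<Sum>i<Suc j. x ^ i / fact i) \<ge> (\<Sum>i\<in>{0}. x ^ i / fact i)"
      using assms by (intro sum_mono2) auto
    then have "pois_below (Suc j) x > 0" unfolding pois_below_def by (intro mult_pos_pos) auto
    then show "1 - pois_below (Suc j) x < 1" by simp
  qed (use assms in \<open>auto simp: lessThan_empty_iff\<close>)
  then show ?thesis by simp
qed

section \<open>The fixed point equation\<close>

lemma positive_root_iff:
  "k \<ge> 1 \<Longrightarrow> positive_root k l r \<longleftrightarrow> r > 0 \<and> trunc_pois l (real k * r) = r"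
  by (auto simp: positive_root_def expectation_min_poisson)

text \<open>Existence: \<open>trunc_pois l (k * r) - r\<close> is positive just to the right of 0
  and negative at \<open>r = l\<close>. Uniqueness: at a root the ratio
  \<open>trunc_pois l t / t\<close> with \<open>t = k * r\<close> equals \<open>1 / k\<close>, and
  this ratio is strictly decreasing.\<close>

lemma ex1_positive_root:
  assumes "k \<ge> 2" "l \<ge> 1"
  shows "\<exists>!r. positive_root k l r"
proof -
  have cont: "continuous_on S (\<lambda>r. trunc_pois l (real k * r) - r)" for S
    by (intro continuous_intros DERIV_continuous_on[THEN continuous_on_compose2, OF DERIV_trunc_pois]) auto
  obtain m where m: "l = Suc m" using assms(2) by (cases l) auto
  \<comment> \<open>The slope at 0 is \<open>k - 1\<close>, since \<open>pois_below l 0 = 1\<close>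
    for \<open>l \<ge> 1\<close>; it is positive because \<open>k \<ge> 2\<close>.\<close>
  have "((\<lambda>r. trunc_pois l (real k * r) - r) has_real_derivative pois_below l (real k * 0) * real k - 1) (at 0)"
    by (auto intro!: derivative_eq_intros DERIV_chain'[OF _ DERIV_trunc_pois])
  moreover have "pois_below l (real k * 0) * real k - 1 > 0" using assms m by simp
  ultimately obtain e where e: "e > 0" "\<And>h. 0 < h \<Longrightarrow> h < e \<Longrightarrow>
      trunc_pois l (real k * 0) - 0 < trunc_pois l (real k * (0 + h)) - (0 + h)"
    using DERIV_pos_inc_right[of "\<lambda>r. trunc_pois l (real k * r) - r" _ 0] by blast
  \<comment> \<open>Halving \<open>e\<close> keeps \<open>a\<close> strictly inside the range of
    positivity; the cap 1 ensures \<open>a \<le> l\<close>.\<close>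
  define a where "a = min (e / 2) 1"
  have a: "0 < a" "a \<le> 1" "0 < trunc_pois l (real k * a) - a"
    using e(1) e(2)[of a] by (auto simp: a_def)
  have "trunc_pois l (real k * real l) - real l < 0" using trunc_pois_less[of "real k * real l" l] assms by simp
  then obtain r where r: "a \<le> r" "r \<le> real l" "trunc_pois l (real k * r) - r = 0"
    using IVT2'[of "\<lambda>r. trunc_pois l (real k * r) - r" "real l" 0 a] a assms cont by fastforce
  show ?thesis
  proof (rule ex1I)
    show "positive_root k l r" using r a assms by (simp add: positive_root_iff)
    fix s assume s: "positive_root k l s"
    have ratio: "trunc_pois l (real k * t) / (real k * t) = 1 / real k" if "positive_root k l t" for t
      using that assms by (auto simp: positive_root_iff)
    show "s = r"
    proof (cases s r rule: linorder_cases)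
      case less
      with s show ?thesis using trunc_pois_ratio_strict_antimono[of "real k * s" "real k * r" l]
        ratio[OF s] ratio[OF \<open>positive_root k l r\<close>] assms by (simp add: positive_root_iff)
    next
      case greater
      with r a show ?thesis using trunc_pois_ratio_strict_antimono[of "real k * r" "real k * s" l]
        ratio[OF s] ratio[OF \<open>positive_root k l r\<close>] assms by (simp add: positive_root_iff)
    qed simp
  qed
qed

section \<open>Loads of random subsets\<close>

text \<open>Double counting of pairs of a set of size \<open>Suc d\<close> and one of its elements:
  removing that element leaves a set of size \<open>d\<close> and a point outside it.\<close>

lemma sum_subsets_Suc:
  fixes g :: "'a set \<Rightarrow> real"
  assumes "finite U"
  shows "real (Suc d) * (\<Sum>D | D \<subseteq> U \<and> card D = Suc d. g D) =
    (\<Sum>D | D \<subseteq> U \<and> card D = d. \<Sum>x\<in>U - D. g (insert x D))"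
proof -
  have fin: "finite {D. D \<subseteq> U \<and> card D = n}" for n
    using assms by (auto intro: finite_subset[of _ "Pow U"])
  have finD: "finite D" if "D \<subseteq> U" for D
    using that assms finite_subset by blast
  have "real (Suc d) * (\<Sum>D | D \<subseteq> U \<and> card D = Suc d. g D) =
      (\<Sum>D | D \<subseteq> U \<and> card D = Suc d. \<Sum>x\<in>D. g D)"
    by (simp add: sum_distrib_left)
  also have "\<dots> = (\<Sum>(D, x)\<in>(SIGMA D:{D. D \<subseteq> U \<and> card D = Suc d}. D). g D)"
    by (rule sum.Sigma) (use fin finD in auto)
  also have "\<dots> = (\<Sum>(D, x)\<in>(SIGMA D:{D. D \<subseteq> U \<and> card D = d}. U - D). g (insert x D))"
    by (rule sum.reindex_bij_witness[where i = "\<lambda>(D, x). (insert x D, x)" and j = "\<lambda>(D, x). (D - {x}, x)"])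
      (auto simp: finD insert_absorb card_insert_if)
  also have "\<dots> = (\<Sum>D | D \<subseteq> U \<and> card D = d. \<Sum>x\<in>U - D. g (insert x D))"
    by (rule sum.Sigma[symmetric]) (use fin assms in auto)
  finally show ?thesis .
qed

lemma choose_le_pow_div_fact: "real (n choose d) \<le> real n ^ d / fact d"
proof -
  have "real ((n choose d) * fact d) \<le> real (n ^ d)"
    using binomial_fact_pow of_nat_le_iff by blast
  then show ?thesis by (simp add: field_simps)
qed

text \<open>
  Conditioning on one element gives a recursion in \<open>d\<close>, which \<open>trunc_pois\<close> solves up to \<open>p\<^sup>2\<close> per step;
  the factor \<open>card U ^ d / fact d\<close> in place of the binomial coefficient absorbs repeated elements.
\<close>

lemma sum_min_card_Int_le:
  assumes "finite U" "U \<noteq> {}" "T \<subseteq> U"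
  defines "p \<equiv> real (card T) / real (card U)"
  shows "(\<Sum>D | D \<subseteq> U \<and> card D = d. real (min n (card (D \<inter> T)))) \<le>
    real (card U) ^ d / fact d * (trunc_pois n (real d * p) + real d * p\<^sup>2)"
proof (induction d arbitrary: n)
  case 0
  have "{D. D \<subseteq> U \<and> card D = 0} = {{}}"
    using assms(1) finite_subset by (auto simp: card_eq_0_iff)
  then show ?case by simp
next
  case (Suc d)
  have u: "real (card U) > 0" using assms by (simp add: card_gt_0_iff)
  have KU: "card T \<le> card U" using assms by (simp add: card_mono)
  have p01: "0 \<le> p" "p \<le> 1" using KU u by (auto simp: p_def divide_le_eq)
  define P where "P = real (card U) ^ d / fact d"
  have "P \<ge> 0" by (simp add: P_def)
  show ?case
  proof (cases n)
    case 0
    then show ?thesis by (auto simp: p_def)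
  next
    case (Suc m)
    \<comment> \<open>The threshold stays variable because the recursion uses both \<open>n\<close>
      and \<open>n - 1\<close>.\<close>
    define a where "a = (\<lambda>n. \<Sum>D | D \<subseteq> U \<and> card D = d. real (min n (card (D \<inter> T))))"
    have IH: "a n \<le> P * (trunc_pois n (real d * p) + real d * p\<^sup>2)" for n
      using Suc.IH[of n] by (simp add: a_def P_def)
    \<comment> \<open>A new element of \<open>T\<close> adds 1 to the load, and
      \<open>min (Suc m) (Suc c) = 1 + min m c\<close> lowers the threshold; other elements change
      nothing. The sum is then extended from \<open>U - D\<close> to \<open>U\<close>, as if
      repeated draws were allowed.\<close>
    have pointwise: "(\<Sum>x\<in>U - D. real (min n (card (insert x D \<inter> T)))) \<le>
       real (card T) * (1 + real (min m (card (D \<inter> T)))) +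
       (real (card U) - real (card T)) * real (min n (card (D \<inter> T)))"
      if "D \<subseteq> U" for D
    proof -
      have finD: "finite D" using that assms(1) finite_subset by blast
      have "(\<Sum>x\<in>U - D. real (min n (card (insert x D \<inter> T)))) \<le>
        (\<Sum>x\<in>U - D. if x \<in> T then 1 + real (min m (card (D \<inter> T))) else real (min n (card (D \<inter> T))))"
        using finD Suc by (intro sum_mono) (auto simp: Int_insert_left)
      also have "\<dots> \<le> (\<Sum>x\<in>U. if x \<in> T then 1 + real (min m (card (D \<inter> T))) else real (min n (card (D \<inter> T))))"
        using assms(1) by (intro sum_mono2) auto
      also have "\<dots> = real (card T) * (1 + real (min m (card (D \<inter> T)))) +
        real (card (U - T)) * real (min n (card (D \<inter> T)))"
      proof -
        have "U \<inter> {x. x \<in> T} = T" "U \<inter> - {x. x \<in> T} = U - T" using assms(3) by auto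
        then show ?thesis using assms(1) by (simp add: sum.If_cases del: of_nat_min)
      qed
      also have "real (card (U - T)) = real (card U) - real (card T)"
        using assms KU finite_subset by (subst card_Diff_subset) auto
      finally show ?thesis .
    qed
    have "real (Suc d) * (\<Sum>D | D \<subseteq> U \<and> card D = Suc d. real (min n (card (D \<inter> T)))) \<le>
      (\<Sum>D | D \<subseteq> U \<and> card D = d. real (card T) * (1 + real (min m (card (D \<inter> T)))) +
       (real (card U) - real (card T)) * real (min n (card (D \<inter> T))))"
      unfolding sum_subsets_Suc[OF assms(1)] by (intro sum_mono pointwise) auto
    also have "\<dots> = real (card T) * (real (card U choose d) + a m) + (real (card U) - real (card T)) * a n"
      by (simp only: sum.distrib sum_distrib_left[symmetric] a_def)
        (simp add: n_subsets[OF assms(1)] del: of_nat_min)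
    also have "\<dots> \<le> real (card T) * (P + P * (trunc_pois m (real d * p) + real d * p\<^sup>2)) +
      (real (card U) - real (card T)) * (P * (trunc_pois n (real d * p) + real d * p\<^sup>2))"
      using KU IH choose_le_pow_div_fact[of "card U" d] unfolding P_def[symmetric]
      by (intro add_mono mult_left_mono) auto
    \<comment> \<open>By \<open>trunc_pois_Suc\<close>, \<open>1 + trunc_pois m\<close> equals
      \<open>trunc_pois n + pois_below n\<close>, so mixing the two cases with weights
      \<open>p\<close> and \<open>1 - p\<close> gives the left side of
      \<open>trunc_pois_step\<close>.\<close>
    also have "\<dots> = P * card U * (trunc_pois n (real d * p) + p * pois_below n (real d * p) + real d * p\<^sup>2)"
    proof -
      have T: "real (card T) = p * real (card U)" using u by (simp add: p_def)
      show ?thesis unfolding T by (simp add: Suc trunc_pois_Suc algebra_simps)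
    qed
    also have "\<dots> \<le> P * card U * (trunc_pois n (real d * p + p) + p\<^sup>2 + real d * p\<^sup>2)"
      using trunc_pois_step[of "real d * p" p n] p01 \<open>P \<ge> 0\<close> by (intro mult_left_mono) auto
    finally have "(\<Sum>D | D \<subseteq> U \<and> card D = Suc d. real (min n (card (D \<inter> T)))) \<le>
       P * card U * (trunc_pois n (real d * p + p) + p\<^sup>2 + real d * p\<^sup>2) / real (Suc d)"
      by (simp add: field_simps del: of_nat_min)
    also have "\<dots> = real (card U) ^ Suc d / fact (Suc d) * (trunc_pois n (real (Suc d) * p) + real (Suc d) * p\<^sup>2)"
      by (simp add: P_def field_simps)
    finally show ?thesis .
  qed
qed

text \<open>An error linear in \<open>p\<close> can be summed over all cells knowing only the sum of
  the \<open>p\<close>. If \<open>sqrt d * p \<le> 1\<close>, then \<open>d * p\<^sup>2\<close> is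
  at most \<open>sqrt d * p\<close>; otherwise the error term alone exceeds the trivial bound
  \<open>n\<close>.\<close>

lemma sum_min_card_Int_le_sqrt:
  assumes "finite U" "U \<noteq> {}" "T \<subseteq> U" "n \<ge> 1"
  defines "p \<equiv> real (card T) / real (card U)"
  shows "(\<Sum>D | D \<subseteq> U \<and> card D = d. real (min n (card (D \<inter> T)))) \<le>
    real (card U) ^ d / fact d * (trunc_pois n (real d * p) + real n * sqrt (real d) * p)"
proof (cases "sqrt (real d) * p \<le> 1")
  case True
  have "p \<ge> 0" by (simp add: p_def)
  have "real d * p\<^sup>2 = (sqrt (real d) * p) * (sqrt (real d) * p)"
    by (simp add: power2_eq_square)
  also have "\<dots> \<le> (sqrt (real d) * p) * 1" using True \<open>p \<ge> 0\<close> by (intro mult_left_mono) auto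
  also have "\<dots> \<le> real n * (sqrt (real d) * p)"
    using mult_right_mono[of 1 "real n" "sqrt (real d) * p"] assms(4) \<open>p \<ge> 0\<close> by simp
  finally have "real d * p\<^sup>2 \<le> real n * sqrt (real d) * p" by (simp add: mult.assoc)
  then have "real (card U) ^ d / fact d * (trunc_pois n (real d * p) + real d * p\<^sup>2) \<le>
      real (card U) ^ d / fact d * (trunc_pois n (real d * p) + real n * sqrt (real d) * p)"
    by (intro mult_left_mono) auto
  with sum_min_card_Int_le[OF assms(1-3), of n d] show ?thesis unfolding p_def by linarith
next
  case False
  have "(\<Sum>D | D \<subseteq> U \<and> card D = d. real (min n (card (D \<inter> T)))) \<le>
      (\<Sum>D | D \<subseteq> U \<and> card D = d. real n)"
    by (intro sum_mono) auto
  also have "\<dots> = real (card U choose d) * real n" by (simp add: n_subsets assms(1))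
  also have "\<dots> \<le> real (card U) ^ d / fact d * real n"
    by (intro mult_right_mono choose_le_pow_div_fact) auto
  also have "\<dots> \<le> real (card U) ^ d / fact d * (trunc_pois n (real d * p) + real n * sqrt (real d) * p)"
  proof (intro mult_left_mono)
    have "real n * 1 \<le> real n * (sqrt (real d) * p)" using False by (intro mult_left_mono) auto
    moreover have "0 \<le> trunc_pois n (real d * p)" by (intro trunc_pois_nonneg) (simp add: p_def)
    ultimately show "real n \<le> trunc_pois n (real d * p) + real n * sqrt (real d) * p"
      by (simp add: mult.assoc)
  qed auto
  finally show ?thesis .
qed

text \<open>Jensen's inequality, by summing the tangent bound at the common point
  \<open>s / card I\<close>. As the slope there is nonnegative, an upper bound \<open>s\<close> on
  the sum suffices.\<close>

lemma sum_trunc_pois_le: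
  assumes "finite I" "\<And>i. i \<in> I \<Longrightarrow> 0 \<le> x i" "(\<Sum>i\<in>I. x i) \<le> s"
  shows "(\<Sum>i\<in>I. trunc_pois n (x i)) \<le> real (card I) * trunc_pois n (s / real (card I))"
proof (cases "I = {}")
  case False
  define c where "c = s / real (card I)"
  have s: "0 \<le> s" using sum_nonneg[of I x] assms by auto
  then have c: "0 \<le> c" "real (card I) * c = s" using False assms(1) by (auto simp: c_def)
  have "(\<Sum>i\<in>I. trunc_pois n (x i)) \<le> (\<Sum>i\<in>I. trunc_pois n c + pois_below n c * (x i - c))"
    using assms c by (intro sum_mono trunc_pois_le_tangent) auto
  also have "\<dots> = real (card I) * trunc_pois n c + pois_below n c * ((\<Sum>i\<in>I. x i) - s)"
    by (simp add: sum.distrib sum_subtractf c(2)[symmetric] flip: sum_distrib_left)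
  also have "\<dots> \<le> real (card I) * trunc_pois n c"
    using mult_nonneg_nonpos[OF pois_below_nonneg[OF c(1), of n], of "(\<Sum>i\<in>I. x i) - s"] assms(3) by auto
  finally show ?thesis by (simp add: c_def)
qed simp

text \<open>The fraction \<open>p i\<close> of the universe writing to cell \<open>i\<close> sums
  over the cells to the average support size, hence to at most \<open>k\<close>. The bounds per cell
  are added and combined by Jensen's inequality.\<close>

lemma sum_load_le:
  fixes S :: "'a \<Rightarrow> nat set"
  assumes "finite U" "U \<noteq> {}" "l \<ge> 1"
    and S: "\<And>x. x \<in> U \<Longrightarrow> S x \<subseteq> {1..M} \<and> card (S x) \<le> k"
  shows "(\<Sum>D | D \<subseteq> U \<and> card D = d. \<Sum>i\<in>{1..M}. real (min l (card (D \<inter> {x \<in> U. i \<in> S x})))) \<le>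
    real (card U) ^ d / fact d *
      (real M * trunc_pois l (real k * real d / real M) + real l * real k * sqrt (real d))"
proof -
  define p where "p = (\<lambda>i. real (card {x \<in> U. i \<in> S x}) / real (card U))"
  have u: "real (card U) > 0" using assms by (simp add: card_gt_0_iff)
  have "(\<Sum>i\<in>{1..M}. card {x \<in> U. i \<in> S x}) = (\<Sum>x\<in>U. card (S x))"
  proof -
    have "(\<Sum>i\<in>{1..M}. card {x \<in> U. i \<in> S x}) = (\<Sum>x\<in>U. card {i \<in> {1..M}. i \<in> S x})"
      by (rule sum_multicount_gen) (use assms(1) in auto)
    also have "\<dots> = (\<Sum>x\<in>U. card (S x))"
    proof (intro sum.cong refl arg_cong[where f = card])
      fix x assume "x \<in> U"
      from S[OF this] show "{i \<in> {1..M}. i \<in> S x} = S x" by blast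
    qed
    finally show ?thesis .
  qed
  also have "\<dots> \<le> (\<Sum>x\<in>U. k)" using S by (intro sum_mono) auto
  finally have "real (\<Sum>i\<in>{1..M}. card {x \<in> U. i \<in> S x}) \<le> real (card U * k)"
    by (simp only: of_nat_le_iff sum_constant of_nat_id)
  then have psum: "(\<Sum>i\<in>{1..M}. p i) \<le> real k"
    using u by (simp add: p_def sum_divide_distrib[symmetric] field_simps)
  have p0: "p i \<ge> 0" for i by (simp add: p_def)
  have "(\<Sum>D | D \<subseteq> U \<and> card D = d. \<Sum>i\<in>{1..M}. real (min l (card (D \<inter> {x \<in> U. i \<in> S x})))) =
    (\<Sum>i\<in>{1..M}. \<Sum>D | D \<subseteq> U \<and> card D = d. real (min l (card (D \<inter> {x \<in> U. i \<in> S x}))))"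
    by (rule sum.swap)
  also have "\<dots> \<le> (\<Sum>i\<in>{1..M}. real (card U) ^ d / fact d *
      (trunc_pois l (real d * p i) + real l * sqrt (real d) * p i))"
    unfolding p_def using assms by (intro sum_mono sum_min_card_Int_le_sqrt) auto
  also have "\<dots> = real (card U) ^ d / fact d *
      ((\<Sum>i\<in>{1..M}. trunc_pois l (real d * p i)) + real l * sqrt (real d) * (\<Sum>i\<in>{1..M}. p i))"
    by (simp only: sum.distrib sum_distrib_left distrib_left)
  also have "\<dots> \<le> real (card U) ^ d / fact d *
      (real M * trunc_pois l (real k * real d / real M) + real l * sqrt (real d) * real k)"
  proof (intro mult_left_mono add_mono psum)
    have "(\<Sum>i\<in>{1..M}. real d * p i) \<le> real k * real d"
      using mult_left_mono[OF psum, of "real d"] by (simp add: sum_distrib_left mult.commute)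
    then show "(\<Sum>i\<in>{1..M}. trunc_pois l (real d * p i)) \<le> real M * trunc_pois l (real k * real d / real M)"
      using sum_trunc_pois_le[of "{1..M}" "\<lambda>i. real d * p i" "real k * real d" l] p0 by simp
  qed auto
  finally show ?thesis by (simp add: mult_ac)
qed

section \<open>Counting underloaded sets\<close>

text \<open>There are at most \<open>(d + 1) ^ M\<close> load vectors. For a fixed one, an injective
  encoding is limited by the product of the numbers of contents per cell; its exponent of
  \<open>V\<close> is an integer below \<open>d\<close>, which saves a full factor \<open>V\<close>.
  The factor \<open>B\<close> allows for slightly larger cells.\<close>

lemma card_underloaded_le:
  fixes enc :: "'a set \<Rightarrow> nat \<Rightarrow> 'c"
  assumes "finite U" "card U \<le> V" "1 \<le> (B::real)"
    and \<S>: "\<S> \<subseteq> {D. D \<subseteq> U \<and> card D = d}" "inj_on enc \<S>"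
    and enc: "\<And>D. D \<subseteq> U \<Longrightarrow> enc D \<in> (\<Pi>\<^sub>E i\<in>{1..M}. C i)"
    and loc: "\<And>D i. D \<subseteq> U \<Longrightarrow> i \<in> {1..M} \<Longrightarrow> enc D i = enc (D \<inter> T i) i"
    and C: "\<And>i. i \<in> {1..M} \<Longrightarrow> finite (C i) \<and> real (card (C i)) \<le> real V ^ l * B"
    and load: "\<And>D. D \<in> \<S> \<Longrightarrow> (\<Sum>i\<in>{1..M}. min l (card (D \<inter> T i))) < d"
    and "V \<ge> 1"
  shows "real (card \<S>) \<le> real (d + 1) ^ M * (real V ^ (d - 1) * B ^ M)"
proof -
  define Q where "Q = (\<lambda>n. {D \<in> \<S>. \<forall>i\<in>{1..M}. card (D \<inter> T i) = n i})"
  have finS: "finite \<S>" using \<S>(1) assms(1) by (auto intro: finite_subset[of _ "Pow U"])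
  have "\<S> \<subseteq> (\<Union>n\<in>({1..M} \<rightarrow>\<^sub>E {..d}). Q n)"
  proof
    fix D assume D: "D \<in> \<S>"
    then have "D \<subseteq> U" "card D = d" using \<S>(1) by auto
    then have "finite D" using assms(1) finite_subset by blast
    then have "card (D \<inter> T i) \<le> d" for i
      using card_mono[of D "D \<inter> T i"] \<open>card D = d\<close> by auto
    then have "restrict (\<lambda>i. card (D \<inter> T i)) {1..M} \<in> {1..M} \<rightarrow>\<^sub>E {..d}" by auto
    moreover have "D \<in> Q (restrict (\<lambda>i. card (D \<inter> T i)) {1..M})" using D by (auto simp: Q_def)
    ultimately show "D \<in> (\<Union>n\<in>({1..M} \<rightarrow>\<^sub>E {..d}). Q n)" by blast
  qed
  moreover have finPi: "finite ({1..M} \<rightarrow>\<^sub>E {..d})" by (intro finite_PiE) auto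
  moreover have "finite (Q n)" for n using finS by (simp add: Q_def)
  ultimately have "card \<S> \<le> card (\<Union>n\<in>({1..M} \<rightarrow>\<^sub>E {..d}). Q n)" by (intro card_mono) auto
  also have "\<dots> \<le> (\<Sum>n\<in>({1..M} \<rightarrow>\<^sub>E {..d}). card (Q n))" by (rule card_UN_le[OF finPi])
  finally have "real (card \<S>) \<le> (\<Sum>n\<in>({1..M} \<rightarrow>\<^sub>E {..d}). real (card (Q n)))"
    by (metis of_nat_le_iff of_nat_sum)
  also have "\<dots> \<le> (\<Sum>n\<in>({1..M} \<rightarrow>\<^sub>E {..d}). real V ^ (d - 1) * B ^ M)"
  proof (rule sum_mono)
    fix n
    show "real (card (Q n)) \<le> real V ^ (d - 1) * B ^ M"
    \<comment> \<open>A member of a nonempty class transfers the load bound to the vector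
      \<open>n\<close>.\<close>
    proof (cases "Q n = {}")
      case False
      then obtain D where D: "D \<in> \<S>" "\<And>i. i \<in> {1..M} \<Longrightarrow> card (D \<inter> T i) = n i" by (auto simp: Q_def)
      then have nsum: "(\<Sum>i\<in>{1..M}. min l (n i)) \<le> d - 1" using load[OF D(1)] by simp
      define E where "E = (\<lambda>i. (\<lambda>A. enc A i) ` {A. A \<subseteq> U \<and> card A = n i} \<inter> C i)"
      have finU: "finite {A. A \<subseteq> U \<and> card A = m}" for m
        using assms(1) by (auto intro: finite_subset[of _ "Pow U"])
      have finE: "finite (E i)" for i using finU by (auto simp: E_def)
      \<comment> \<open>Saturated cells are limited by their number of states, the others by the
        number of \<open>n i\<close>-subsets of \<open>U\<close>; the intersection in
        \<open>E i\<close> permits either bound.\<close>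
      have cardE: "real (card (E i)) \<le> real V ^ min l (n i) * B" if i: "i \<in> {1..M}" for i
      proof (cases "l \<le> n i")
        case True
        have "card (E i) \<le> card (C i)" using C[OF i] by (intro card_mono) (auto simp: E_def)
        with C[OF i] True show ?thesis by (simp add: min_def)
      next
        case False
        have "card (E i) \<le> card ((\<lambda>A. enc A i) ` {A. A \<subseteq> U \<and> card A = n i})"
          using finU by (intro card_mono) (auto simp: E_def)
        also have "\<dots> \<le> card {A. A \<subseteq> U \<and> card A = n i}" by (rule card_image_le[OF finU])
        also have "\<dots> = card U choose n i" by (rule n_subsets[OF assms(1)])
        also have "\<dots> \<le> card U ^ n i"
          using binomial_fact_pow[of "card U" "n i"] fact_ge_1[of "n i"]
          by (metis dual_order.trans mult.right_neutral mult_le_mono2)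
        also have "\<dots> \<le> V ^ n i" using assms(2) by (rule power_mono) simp
        finally have "real (card (E i)) \<le> real V ^ n i" by (metis of_nat_le_iff of_nat_power)
        also have "\<dots> \<le> real V ^ n i * B" using assms(3) mult_left_mono[of 1 B "real V ^ n i"] by simp
        finally show ?thesis using False by (simp add: min_def)
      qed
      have "enc ` Q n \<subseteq> (\<Pi>\<^sub>E i\<in>{1..M}. E i)"
      proof (rule image_subsetI, rule PiE_I)
        fix D i assume DQ: "D \<in> Q n" and i: "i \<in> {1..M}"
        then have "D \<subseteq> U" using \<S>(1) by (auto simp: Q_def)
        moreover have "enc D i \<in> C i" using enc[OF \<open>D \<subseteq> U\<close>] i by (rule PiE_mem)
        ultimately show "enc D i \<in> E i" using loc[of D i] DQ i
          by (auto simp: E_def Q_def intro!: image_eqI[of _ _ "D \<inter> T i"])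
      next
        fix D i assume DQ: "D \<in> Q n" and i: "i \<notin> {1..M}"
        then have "D \<subseteq> U" using \<S>(1) by (auto simp: Q_def)
        then show "enc D i = undefined" using enc i by (blast intro: PiE_arb)
      qed
      moreover have "inj_on enc (Q n)" using \<S>(2) by (rule inj_on_subset) (auto simp: Q_def)
      ultimately have "card (Q n) \<le> card (\<Pi>\<^sub>E i\<in>{1..M}. E i)"
        using finE by (intro card_inj_on_le[of enc] finite_PiE) auto
      also have "\<dots> = (\<Prod>i\<in>{1..M}. card (E i))" by (simp add: card_PiE)
      finally have "real (card (Q n)) \<le> (\<Prod>i\<in>{1..M}. real (card (E i)))"
        by (metis of_nat_le_iff of_nat_prod)
      also have "\<dots> \<le> (\<Prod>i\<in>{1..M}. real V ^ min l (n i) * B)"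
        using cardE by (intro prod_mono) auto
      also have "\<dots> = real V ^ (\<Sum>i\<in>{1..M}. min l (n i)) * B ^ M"
        by (simp add: prod.distrib power_sum)
      also have "\<dots> \<le> real V ^ (d - 1) * B ^ M"
        using nsum assms(3) \<open>V \<ge> 1\<close> by (intro mult_right_mono power_increasing) auto
      finally show ?thesis .
    qed (use assms(3) in auto)
  qed
  also have "\<dots> = real (d + 1) ^ M * (real V ^ (d - 1) * B ^ M)"
    by (simp add: card_PiE)
  finally show ?thesis .
qed

section \<open>Sketch families\<close>

lemma nz_universe_eq: "nz_universe V = {1..int V - 1}"
  by (auto simp: nz_universe_def residue_ring_def)

lemma finite_nz_universe [simp]: "finite (nz_universe V)"
  and card_nz_universe [simp]: "card (nz_universe V) = V - 1"
  by (simp_all add: nz_universe_eq nat_diff_distrib')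

lemma primes_at_top_le: "primes_at_top \<le> at_top"
  by (simp add: primes_at_top_def)

lemma eventually_primes_at_top:
  "eventually P primes_at_top \<longleftrightarrow> eventually (\<lambda>V. prime V \<longrightarrow> P V) at_top"
  by (simp add: primes_at_top_def eventually_inf_principal)

text \<open>There are infinitely many primes. Nontriviality of the filter lets \<open>Liminf\<close>
  be computed as a limit.\<close>

lemma primes_at_top_neq_bot: "primes_at_top \<noteq> bot"
proof -
  have "\<not> eventually (\<lambda>V. prime V \<longrightarrow> False) (at_top :: nat filter)"
    using bigger_prime by (auto simp: eventually_at_top_linorder) (meson less_imp_le)
  then show ?thesis unfolding trivial_limit_def eventually_primes_at_top .
qed

section \<open>Encodings under fixed public randomness\<close>

context
  fixes k l :: nat and \<A> :: "('w, 'c) sketch_family" and d V :: nat and \<omega> :: 'w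
  assumes fsc: "fixed_support_canonical k l \<A>" and V: "prime V"
    and \<omega>: "\<omega> \<in> space (randomness \<A> d V)"
begin

lemma encode_in_states: "A \<subseteq> nz_universe V \<Longrightarrow> encode \<A> d V \<omega> A \<in> sketch_states \<A> d V"
  using fsc V \<omega> unfolding fixed_support_canonical_def by blast

lemma write_support_bounds:
  "x \<in> nz_universe V \<Longrightarrow>
    write_support \<A> d V \<omega> x \<subseteq> {1..num_cells \<A> d} \<and> card (write_support \<A> d V \<omega> x) \<le> k"
  using fsc V \<omega> unfolding fixed_support_canonical_def by blast

lemma encode_insert_other:
  assumes "A \<subseteq> nz_universe V" "x \<in> nz_universe V" "x \<notin> A"
    and "i \<in> {1..num_cells \<A> d}" "i \<notin> write_support \<A> d V \<omega> x"
  shows "encode \<A> d V \<omega> (insert x A) i = encode \<A> d V \<omega> A i"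
proof -
  have "encode \<A> d V \<omega> (A \<union> {x}) = update \<A> d V \<omega> x (encode \<A> d V \<omega> A)"
    using fsc V \<omega> assms(1-3) unfolding fixed_support_canonical_def by blast
  moreover have "\<forall>s\<in>sketch_states \<A> d V. \<forall>i\<in>{1..num_cells \<A> d} - write_support \<A> d V \<omega> x.
      update \<A> d V \<omega> x s i = s i"
    using fsc V \<omega> assms(2) unfolding fixed_support_canonical_def by blast
  ultimately show ?thesis using assms encode_in_states[OF assms(1)] by simp
qed

text \<open>Canonicality lets the elements not writing to cell \<open>i\<close> be inserted last.\<close>

lemma encode_local:
  assumes "A \<subseteq> nz_universe V" and i: "i \<in> {1..num_cells \<A> d}"
  shows "encode \<A> d V \<omega> A i =
    encode \<A> d V \<omega> (A \<inter> {x \<in> nz_universe V. i \<in> write_support \<A> d V \<omega> x}) i"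
proof -
  define B where "B = A \<inter> {x \<in> nz_universe V. i \<in> write_support \<A> d V \<omega> x}"
  have "encode \<A> d V \<omega> (B \<union> C) i = encode \<A> d V \<omega> B i" if "C \<subseteq> A - B" for C
  proof -
    have "finite C" using that assms(1) finite_subset[OF _ finite_nz_universe, of C V] by blast
    then show ?thesis using that
    proof (induction C rule: finite_induct)
      case (insert x C)
      then have "encode \<A> d V \<omega> (insert x (B \<union> C)) i = encode \<A> d V \<omega> (B \<union> C) i"
        using assms by (intro encode_insert_other) (auto simp: B_def)
      with insert show ?case by simp
    qed simp
  qed
  from this[of "A - B"] have "encode \<A> d V \<omega> A i = encode \<A> d V \<omega> B i"
    by (simp add: B_def Un_absorb1 Int_lower1)
  then show ?thesis by (simp add: B_def)
qed

text \<open>The decoded sets are split by whether the total truncated load \<open>X\<close> reaches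
  \<open>d\<close>. Those that reach it are counted by Markov's inequality, the others by
  \<open>card_underloaded_le\<close>. The bound does not depend on the randomness, so it survives
  averaging.\<close>

lemma succ_given_le:
  assumes "l \<ge> 1" "d \<ge> 1" "d < V"
    and cells: "\<And>i. i \<in> {1..num_cells \<A> d} \<Longrightarrow> finite (cell_values \<A> d V i) \<and>
      real (card (cell_values \<A> d V i)) \<le> real V powr (real l + r)"
  defines "M \<equiv> num_cells \<A> d" and "N \<equiv> real (V - 1 choose d)"
  shows "succ_given \<A> d V \<omega> \<le>
    real (V - 1) ^ d / fact d / N *
      ((real M * trunc_pois l (real k * real d / real M) + real l * real k * sqrt (real d)) / real d) +
    real (d + 1) ^ M * (real V ^ (d - 1) * (real V powr \<bar>r\<bar>) ^ M) / N"
proof -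
  define U where "U = nz_universe V"
  define T where "T = (\<lambda>i. {x \<in> U. i \<in> write_support \<A> d V \<omega> x})"
  define enc where "enc = encode \<A> d V \<omega>"
  define X where "X = (\<lambda>D. \<Sum>i\<in>{1..M}. min l (card (D \<inter> T i)))"
  define W where "W = {D. D \<subseteq> U \<and> card D = d}"
  define S where "S = {D \<in> W. decode \<A> d V \<omega> (enc D, enc {}) = (D, {})}"
  have V2: "V \<ge> 2" using V by (rule prime_ge_2_nat)
  have finU: "finite U" and cardU: "card U = V - 1" and "U \<noteq> {}"
    using V2 card_nz_universe[of V] by (auto simp: U_def simp del: card_nz_universe)
  have cardW: "card W = (V - 1 choose d)" unfolding W_def using n_subsets[OF finU] cardU by simp
  have finW: "finite W" using finU by (auto simp: W_def intro: finite_subset[of _ "Pow U"])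
  have N: "N > 0" using assms(3) by (simp add: N_def zero_less_binomial_iff)
  then have "W \<noteq> {}" using cardW by (auto simp: N_def)
  have succ_eq: "succ_given \<A> d V \<omega> = real (card S) / N"
  proof -
    have "succ_given \<A> d V \<omega> = real (card (W \<inter> {D. decode \<A> d V \<omega> (enc D, enc {}) = (D, {})})) / real (card W)"
      unfolding succ_given_def enc_def W_def[unfolded U_def, symmetric]
      using finW \<open>W \<noteq> {}\<close> by (intro measure_pmf_of_set) (simp_all add: W_def U_def)
    then show ?thesis by (simp add: S_def N_def cardW Int_def)
  qed
  \<comment> \<open>On \<open>S\<close> the decoder recovers the set from its encoding, the encoding
    of the empty set being fixed.\<close>
  have inj: "inj_on enc S" by (rule inj_onI) (auto simp: S_def)
  have "card {D \<in> S. X D < d} \<le> real (d + 1) ^ M * (real V ^ (d - 1) * (real V powr \<bar>r\<bar>) ^ M)"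
  proof (rule card_underloaded_le[where U = U and enc = enc and T = T and C = "cell_values \<A> d V"])
    show "inj_on enc {D \<in> S. X D < d}" using inj by (rule inj_on_subset) auto
    \<comment> \<open>The exponent \<open>r\<close> may be negative; its absolute value keeps the
      slack factor at least 1.\<close>
    show "1 \<le> real V powr \<bar>r\<bar>" using V2 by (intro ge_one_powr_ge_zero) auto
    show "finite (cell_values \<A> d V i) \<and> real (card (cell_values \<A> d V i)) \<le> real V ^ l * real V powr \<bar>r\<bar>"
      if "i \<in> {1..M}" for i
    proof -
      have "real V powr (real l + r) \<le> real V powr (real l + \<bar>r\<bar>)" using V2 by (intro powr_mono) auto
      also have "\<dots> = real V ^ l * real V powr \<bar>r\<bar>" using V2 by (simp add: powr_add powr_realpow)
      finally show ?thesis using cells that unfolding M_def by force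
    qed
    show "enc D \<in> (\<Pi>\<^sub>E i\<in>{1..M}. cell_values \<A> d V i)" if "D \<subseteq> U" for D
      using encode_in_states that by (simp add: enc_def U_def sketch_states_def M_def)
    show "enc D i = enc (D \<inter> T i) i" if "D \<subseteq> U" "i \<in> {1..M}" for D i
      using encode_local that by (simp add: enc_def U_def M_def T_def)
  qed (use finU cardU V2 in \<open>auto simp: S_def W_def X_def\<close>)
  moreover have "real d * real (card {D \<in> S. d \<le> X D}) \<le>
      real (V - 1) ^ d / fact d * (real M * trunc_pois l (real k * real d / real M) + real l * real k * sqrt (real d))"
  proof -
    have "real d * real (card {D \<in> S. d \<le> X D}) = (\<Sum>D\<in>{D \<in> S. d \<le> X D}. real d)" by simp
    also have "\<dots> \<le> (\<Sum>D\<in>{D \<in> S. d \<le> X D}. real (X D))" by (intro sum_mono) auto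
    also have "\<dots> \<le> (\<Sum>D\<in>W. real (X D))" using finW by (intro sum_mono2) (auto simp: S_def)
    also have "\<dots> = (\<Sum>D | D \<subseteq> U \<and> card D = d. \<Sum>i\<in>{1..M}. real (min l (card (D \<inter> T i))))"
      by (simp add: W_def X_def del: of_nat_min)
    also have "\<dots> \<le> real (card U) ^ d / fact d *
      (real M * trunc_pois l (real k * real d / real M) + real l * real k * sqrt (real d))"
      unfolding T_def using assms(1) finU \<open>U \<noteq> {}\<close> write_support_bounds
      by (intro sum_load_le) (auto simp: U_def M_def)
    finally show ?thesis by (simp only: cardU)
  qed
  moreover have "card S = card {D \<in> S. d \<le> X D} + card {D \<in> S. X D < d}"
  proof -
    have "S = {D \<in> S. d \<le> X D} \<union> {D \<in> S. X D < d}" by auto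
    moreover have "finite S" using finW by (simp add: S_def)
    ultimately show ?thesis by (metis (no_types, lifting) card_Un_disjoint disjoint_iff finite_Un mem_Collect_eq not_le)
  qed
  moreover have "b \<le> u * (w / real d)" if "real d * b \<le> u * w" for b u w :: real
    using that \<open>d \<ge> 1\<close> by (simp add: field_simps)
  ultimately have "real (card S) \<le> real (V - 1) ^ d / fact d *
      ((real M * trunc_pois l (real k * real d / real M) + real l * real k * sqrt (real d)) / real d) +
      real (d + 1) ^ M * (real V ^ (d - 1) * (real V powr \<bar>r\<bar>) ^ M)"
    by (simp only: of_nat_add add_mono)
  from divide_right_mono[OF this, of N] N show ?thesis
    unfolding succ_eq by (simp add: add_divide_distrib)
qed

end

section \<open>Limits in the universe size, then in \<open>d\<close>\<close>

lemma pow_div_choose_tendsto: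
  "(\<lambda>n. real n ^ d / fact d / real (n choose d)) \<longlonglongrightarrow> 1"
proof -
  \<comment> \<open>This also covers \<open>n < d\<close>, where both sides are 0 because division
    by 0 gives 0.\<close>
  have eq: "real n ^ d / fact d / real (n choose d) = (\<Prod>i<d. real n / (real n - real i))" for n
    by (simp add: binomial_gbinomial gbinomial_prod_rev prod_dividef atLeast0LessThan)
  have "(\<lambda>n. \<Prod>i<d. real n / (real n - real i)) \<longlonglongrightarrow> (\<Prod>i<d. 1)"
    by (intro tendsto_prod) real_asymp
  then show ?thesis unfolding eq by simp
qed

text \<open>For fixed \<open>d\<close> the number of cells is fixed too, so the slack of all cells
  together is eventually below \<open>V powr (1 / 2)\<close>. It cannot make up for the factor
  \<open>V\<close> lost by underloaded sets, and only the Markov term remains.\<close>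

lemma Liminf_succ_prob_le:
  fixes \<A> :: "('w, 'c) sketch_family"
  assumes fsc: "fixed_support_canonical k l \<A>" and "l \<ge> 1" "d \<ge> 1"
  defines "M \<equiv> num_cells \<A> d"
  shows "Liminf primes_at_top (\<lambda>V. ereal (succ_prob \<A> d V)) \<le>
    ereal ((real M * trunc_pois l (real k * real d / real M) + real l * real k * sqrt (real d)) / real d)"
proof -
  define c where "c = (real M * trunc_pois l (real k * real d / real M) + real l * real k * sqrt (real d)) / real d"
  define \<kappa> where "\<kappa> = (\<lambda>V. real (V - 1) ^ d / fact d / real (V - 1 choose d))"
  \<comment> \<open>The quotient of \<open>V ^ d\<close> by the binomial coefficient is written as
    \<open>fact d * \<kappa> V * (V / (V - 1)) ^ d\<close>, so that every factor has a known
    limit.\<close>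
  define bnd where "bnd = (\<lambda>V. \<kappa> V * c +
    real (d + 1) ^ M * (fact d * \<kappa> V * (real V / (real V - 1)) ^ d * real V powr (- 1 / 2)))"
  obtain r :: "nat \<Rightarrow> nat \<Rightarrow> real" where r_all: "\<forall>d. (r d \<longlongrightarrow> 0) primes_at_top"
    and cells_all: "\<forall>d V. prime V \<longrightarrow> (\<forall>i\<in>{1..num_cells \<A> d}.
      finite (cell_values \<A> d V i) \<and> real (card (cell_values \<A> d V i)) \<le> real V powr (real l + r d V))"
    using fsc unfolding fixed_support_canonical_def by (elim conjE exE) (rule that)
  have r: "(r d \<longlongrightarrow> 0) primes_at_top" using r_all by blast
  have cells: "finite (cell_values \<A> d V i) \<and> real (card (cell_values \<A> d V i)) \<le> real V powr (real l + r d V)"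
    if "prime V" "i \<in> {1..num_cells \<A> d}" for V i
    using cells_all that by blast
  have "((\<lambda>V. real M * \<bar>r d V\<bar>) \<longlongrightarrow> real M * \<bar>0\<bar>) primes_at_top"
    by (intro tendsto_intros r)
  then have "eventually (\<lambda>V. real M * \<bar>r d V\<bar> < 1 / 2) primes_at_top"
    by (rule order_tendstoD) simp
  moreover have "eventually (\<lambda>V. prime V) primes_at_top"
    by (simp add: eventually_primes_at_top)
  moreover have "eventually (\<lambda>V. d < V) primes_at_top"
    using primes_at_top_le eventually_gt_at_top by (rule filter_leD)
  ultimately have "eventually (\<lambda>V. succ_prob \<A> d V \<le> bnd V) primes_at_top"
  proof eventually_elim
    case (elim V)
    have V2: "V \<ge> 2" using elim(2) by (rule prime_ge_2_nat)
    interpret prob_space "randomness \<A> d V"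
      using fsc elim(2) unfolding fixed_support_canonical_def by blast
    have meas: "succ_given \<A> d V \<in> borel_measurable (randomness \<A> d V)"
      using fsc elim(2,3) unfolding fixed_support_canonical_def by blast
    have int: "integrable (randomness \<A> d V) (succ_given \<A> d V)"
      by (rule integrable_const_bound[where B = 1]) (use meas in \<open>auto simp: succ_given_def\<close>)
    have N: "real (V - 1 choose d) > 0" using elim(3) by (simp add: zero_less_binomial_iff)
    have small: "real V ^ (d - 1) * (real V powr \<bar>r d V\<bar>) ^ M \<le> real V ^ d * real V powr (- 1 / 2)"
    proof -
      have "real V ^ (d - 1) * (real V powr \<bar>r d V\<bar>) ^ M = real V powr (real d - 1 + real M * \<bar>r d V\<bar>)"
      proof -
        have "real V ^ (d - 1) = real V powr (real d - 1)"
          using V2 \<open>d \<ge> 1\<close> powr_realpow[of "real V" "d - 1"] by (simp add: of_nat_diff)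
        moreover have "(real V powr a) ^ M = real V powr (real M * a)" for a
          using V2 powr_realpow[of "real V powr a" M] by (simp add: powr_powr mult.commute)
        ultimately show ?thesis by (simp only: powr_add)
      qed
      also have "\<dots> \<le> real V powr (real d + - 1 / 2)"
        using elim(1) V2 by (intro powr_mono) auto
      also have "\<dots> = real V ^ d * real V powr (- 1 / 2)"
        using V2 by (simp only: powr_add) (simp add: powr_realpow)
      finally show ?thesis .
    qed
    have "succ_given \<A> d V \<omega> \<le> bnd V" if "\<omega> \<in> space (randomness \<A> d V)" for \<omega>
    proof -
      have "succ_given \<A> d V \<omega> \<le> \<kappa> V * c +
        real (d + 1) ^ M * (real V ^ (d - 1) * (real V powr \<bar>r d V\<bar>) ^ M) / real (V - 1 choose d)"
        unfolding \<kappa>_def c_def M_def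
        by (rule succ_given_le[OF fsc elim(2) that \<open>l \<ge> 1\<close> \<open>d \<ge> 1\<close> elim(3) cells[OF elim(2)]])
      also have "\<dots> \<le> \<kappa> V * c + real (d + 1) ^ M * (real V ^ d * real V powr (- 1 / 2)) / real (V - 1 choose d)"
        using small N by (intro add_left_mono divide_right_mono mult_left_mono) auto
      also have "\<dots> = bnd V"
      proof -
        have "real (V - 1) = real V - 1" "real V - 1 > 0" using V2 by auto
        then show ?thesis using N by (simp add: bnd_def \<kappa>_def power_divide)
      qed
      finally show ?thesis .
    qed
    then show ?case unfolding succ_prob_def
      by (intro integral_le_const[OF int]) (auto intro: AE_I2)
  qed
  then have "Liminf primes_at_top (\<lambda>V. ereal (succ_prob \<A> d V)) \<le> Liminf primes_at_top (\<lambda>V. ereal (bnd V))"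
    by (intro Liminf_mono) (auto elim: eventually_mono)
  also have "\<dots> = ereal c"
  proof (rule lim_imp_Liminf[OF primes_at_top_neq_bot])
    have "filterlim (\<lambda>V::nat. V - 1) at_top at_top" by (rule filterlim_minus_const_nat_at_top)
    then have \<kappa>: "\<kappa> \<longlonglongrightarrow> 1"
      unfolding \<kappa>_def by (rule filterlim_compose[OF pow_div_choose_tendsto])
    have "(\<lambda>V. real V / (real V - 1)) \<longlonglongrightarrow> 1" "(\<lambda>V. real V powr (- 1 / 2)) \<longlonglongrightarrow> 0"
      by real_asymp+
    then have "bnd \<longlonglongrightarrow> 1 * c + real (d + 1) ^ M * (fact d * 1 * 1 ^ d * 0)"
      unfolding bnd_def by (intro tendsto_intros \<kappa>)
    then have "(bnd \<longlongrightarrow> c) primes_at_top" by (auto intro: tendsto_mono[OF primes_at_top_le])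
    then show "((\<lambda>V. ereal (bnd V)) \<longlongrightarrow> ereal c) primes_at_top" by simp
  qed
  finally show ?thesis by (simp only: c_def)
qed

text \<open>If \<open>M / d \<le> m < 1 / \<rho>\<close>, then \<open>k * d / M\<close> is at least
  \<open>k / m\<close>, which exceeds \<open>k * \<rho>\<close>. Monotonicity of the ratio then
  keeps the bound on success away from 1, contradicting success for large \<open>d\<close>.\<close>

lemma sketch_cost_liminf_ge:
  fixes \<A> :: "('w, 'c) sketch_family"
  assumes "k \<ge> 2" "l \<ge> 1" and fsc: "fixed_support_canonical k l \<A>" and whp: "whp_successful \<A>"
    and \<rho>: "positive_root k l \<rho>"
  shows "liminf (\<lambda>d. ereal (real (sketch_cost l \<A> d) / real d)) \<ge> ereal (real l / \<rho>)"
proof (unfold le_Liminf_iff, intro allI impI)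
  fix y assume y: "y < ereal (real l / \<rho>)"
  have \<rho>0: "\<rho> > 0" and \<rho>f: "trunc_pois l (real k * \<rho>) = \<rho>"
    using \<rho> assms by (auto simp: positive_root_iff)
  from y obtain z where z: "y < ereal z" "z < real l / \<rho>" using ereal_dense2 by force
  \<comment> \<open>The maximum with half of \<open>l / \<rho>\<close> makes \<open>m\<close>
    positive even if \<open>z\<close> is not, while \<open>m\<close> stays below
    \<open>1 / \<rho>\<close>.\<close>
  define m where "m = max z (real l / \<rho> / 2) / real l"
  have m: "m > 0" "m < 1 / \<rho>" "y < ereal (real l * m)"
  proof -
    have "real l / \<rho> > 0" using \<rho>0 assms by simp
    then have "max z (real l / \<rho> / 2) > 0" "max z (real l / \<rho> / 2) < real l / \<rho>"
      using z by (auto simp: less_max_iff_disj)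
    moreover have "y < ereal (max z (real l / \<rho> / 2))" using z(1) by (meson ereal_less_eq(3) max.cobounded1 order_less_le_trans)
    ultimately show "m > 0" "m < 1 / \<rho>" "y < ereal (real l * m)"
      using assms(2) divide_strict_right_mono[of "max z (real l / \<rho> / 2)" "real l / \<rho>" "real l"]
      by (simp_all add: m_def del: max_less_iff_conj ereal_max)
  qed
  have ratio: "m * trunc_pois l (real k / m) = real k * (trunc_pois l (real k / m) / (real k / m))"
    using m assms by simp
  \<comment> \<open>This is the gap below 1; one half absorbs the failure probability, the other the
    error of order \<open>1 / sqrt d\<close>.\<close>
  define \<eta> where "\<eta> = 1 - m * trunc_pois l (real k / m)"
  have "\<eta> > 0"
  proof -
    have "real k * \<rho> < real k / m" using m \<rho>0 assms by (simp add: field_simps)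
    then have "trunc_pois l (real k / m) / (real k / m) < trunc_pois l (real k * \<rho>) / (real k * \<rho>)"
      using assms \<rho>0 by (intro trunc_pois_ratio_strict_antimono) auto
    also have "\<dots> = 1 / real k" using \<rho>f \<rho>0 by simp
    finally have "real k * (trunc_pois l (real k / m) / (real k / m)) < 1"
      using assms by (simp add: field_simps)
    then show ?thesis by (simp add: \<eta>_def ratio)
  qed
  have "eventually (\<lambda>d. ereal (1 - \<eta> / 2) < Liminf primes_at_top (\<lambda>V. ereal (succ_prob \<A> d V))) sequentially"
    using whp \<open>\<eta> > 0\<close> unfolding whp_successful_def
    by (intro order_tendstoD(1)) (auto simp: one_ereal_def)
  moreover have "eventually (\<lambda>d. real l * real k * sqrt (real d) / real d < \<eta> / 2) sequentially"
  proof (rule order_tendstoD)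
    show "(\<lambda>d. real l * real k * sqrt (real d) / real d) \<longlonglongrightarrow> 0" by real_asymp
  qed (use \<open>\<eta> > 0\<close> in simp)
  moreover have "eventually (\<lambda>d. d \<ge> 1) sequentially" by (rule eventually_ge_at_top)
  ultimately show "eventually (\<lambda>d. y < ereal (real (sketch_cost l \<A> d) / real d)) sequentially"
  proof eventually_elim
    case (elim d)
    define M where "M = num_cells \<A> d"
    have "1 - \<eta> / 2 < (real M * trunc_pois l (real k * real d / real M) + real l * real k * sqrt (real d)) / real d"
      using less_le_trans[OF elim(1) Liminf_succ_prob_le[OF fsc assms(2) elim(3)]] by (simp add: M_def)
    then have "1 - \<eta> < real M * trunc_pois l (real k * real d / real M) / real d"
      using elim(2) unfolding add_divide_distrib by linarith
    then have gt: "m * trunc_pois l (real k / m) < real M * trunc_pois l (real k * real d / real M) / real d"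
      by (simp add: \<eta>_def)
    have "m < real M / real d"
    proof (rule ccontr)
      assume "\<not> m < real M / real d"
      then have le: "real M / real d \<le> m" by simp
      have "M \<noteq> 0"
      proof
        assume "M = 0"
        with gt have "m * trunc_pois l (real k / m) < 0" by simp
        then show False using m trunc_pois_nonneg[of "real k / m" l] by (simp add: mult_less_0_iff)
      qed
      then have kd: "real k / m \<le> real k * real d / real M" using le m elim(3) assms by (simp add: field_simps)
      have "real M * trunc_pois l (real k * real d / real M) / real d =
          real k * (trunc_pois l (real k * real d / real M) / (real k * real d / real M))"
        using assms elim(3) \<open>M \<noteq> 0\<close> by simp
      also have "\<dots> \<le> real k * (trunc_pois l (real k / m) / (real k / m))"
        using kd trunc_pois_ratio_strict_antimono[of "real k / m" "real k * real d / real M" l] m assms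
        by (intro mult_left_mono) (cases "real k / m = real k * real d / real M"; simp)+
      finally show False using gt ratio by simp
    qed
    then have "real l * m < real l * (real M / real d)"
      using assms by (intro mult_strict_left_mono) auto
    then have "real l * m < real (sketch_cost l \<A> d) / real d"
      by (simp add: sketch_cost_def M_def)
    with m(3) show ?case by (meson ereal_less_eq(3) less_imp_le order_less_le_trans)
  qed
qed

theorem theorem3:
  fixes k l :: nat
  assumes "k \<ge> 2" and "l \<ge> 1"
  shows "(\<exists>!\<rho>. positive_root k l \<rho>) \<and> 0 < rho k l \<and> rho k l < real l \<and>
    (\<forall>\<A> :: ('w, 'c) sketch_family.
       fixed_support_canonical k l \<A> \<and> whp_successful \<A> \<longrightarrow>
         liminf (\<lambda>d. ereal (real (sketch_cost l \<A> d) / real d)) \<ge> ereal (real l / rho k l)) \<and>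
    real l / rho k l > 1"
proof -
  have ex1: "\<exists>!\<rho>. positive_root k l \<rho>" by (rule ex1_positive_root[OF assms])
  then have root: "positive_root k l (rho k l)" unfolding rho_def by (rule theI')
  then have "0 < rho k l" "trunc_pois l (real k * rho k l) = rho k l"
    using assms by (auto simp: positive_root_iff)
  \<comment> \<open>The root is itself a value of \<open>trunc_pois l\<close>, so it lies below
    \<open>l\<close>; hence the last strict inequality.\<close>
  moreover from this have "rho k l < real l"
    using trunc_pois_less[of "real k * rho k l" l] assms by simp
  ultimately show ?thesis
    using ex1 root sketch_cost_liminf_ge[OF assms] by auto
qed

end
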